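(* Let $\{\mathcal{G}_j : j \in J\}$ be an HS-frame for $\mathbb{H}$ with respect to $\mathbb{K}$ and let $\{\varGamma_j : j \in J\}$ be an alternate dual HS-frame of $\{\mathcal{G}_j : j \in J\}$. Then for every bounded sequence $\{w_j : j \in J\}$ of scalars and every $f \in \mathbb{H}$, \begin{eqnarray*} && \bigg( \sum_{j \in J} w_j \big[ \varGamma_j (f),\mathcal{G}_j (f) \big]_{\tau} \bigg)+ \bigg\Vert \sum_{j \in J} (1-w_j) \mathcal{G}_j^* \varGamma_j (f) \bigg\Vert^2 \\ &=& \overline{\bigg( \sum_{j \in J}(1-w_j) \big[ \varGamma_j (f),\mathcal{G}_j (f) \big]_{\tau} \bigg)}+ \bigg\Vert \sum_{j \in J} w_j \mathcal{G}_j^* \varGamma_j (f) \bigg\Vert^2. \end{eqnarray*}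
   Context: $\mathbb{H}$ and $\mathbb{K}$ are complex Hilbert spaces (scalars are complex numbers) and $J$ is a countable index set. $C_2 \subseteq \mathcal{L}(\mathbb{K})$ denotes the Hilbert-Schmidt class of operators on $\mathbb{K}$, a Hilbert space with inner product $[T,S]_\tau = \tau(S^*T)$ ($\tau$ the usual trace) and norm $\Vert T\Vert_2 = [T,T]_\tau^{1/2}$. A family $\{\mathcal{G}_j : j \in J\}$ of bounded linear operators from $\mathbb{H}$ to $C_2 \subseteq \mathcal{L}(\mathbb{K})$ is a Hilbert-Schmidt frame (HS-frame) for $\mathbb{H}$ with respect to $\mathbb{K}$ if there are constants $A,B>0$ such that $A\Vert f\Vert^2 \le \sum_{j\in J}\Vert \mathcal{G}_j(f)\Vert_2^2 \le B\Vert f\Vert^2$ for all $f\in\mathbb{H}$. $\mathcal{G}_j^*: C_2 \to \mathbb{H}$ is the adjoint of $\mathcal{G}_j$. An HS-frame $\{\varGamma_j : j\in J\}$ for $\mathbb{H}$ with respect to $\mathbb{K}$ is an alternate dual HS-frame of $\{\mathcal{G}_j : j\in J\}$ if $f=\sum_{j\in J}\mathcal{G}_j^*\varGamma_j f=\sum_{j\in J}\varGamma_j^*\mathcal{G}_j f$ for all $f\in\mathbb{H}$. Series are understood as unconditionally convergent. *)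

theory Defs
  imports "HOL-Analysis.Analysis"
begin

section \<open>Complex Hilbert spaces\<close>

text \<open>The inner product is linear in the first and conjugate-linear in the second argument.
  Positive definiteness is contained in \<open>cinner_self\<close> and the norm axioms.\<close>

class complex_inner = real_normed_vector +
  fixes scaleC :: "complex \<Rightarrow> 'a \<Rightarrow> 'a" (infixr "*\<^sub>C" 75)
    and cinner :: "'a \<Rightarrow> 'a \<Rightarrow> complex"
  assumes scaleC_add_right: "a *\<^sub>C (x + y) = a *\<^sub>C x + a *\<^sub>C y"
    and scaleC_add_left: "(a + b) *\<^sub>C x = a *\<^sub>C x + b *\<^sub>C x"
    and scaleC_scaleC [simp]: "a *\<^sub>C b *\<^sub>C x = (a * b) *\<^sub>C x"
    and scaleC_of_real: "complex_of_real r *\<^sub>C x = r *\<^sub>R x"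
    and cinner_commute: "cinner x y = cnj (cinner y x)"
    and cinner_add_left: "cinner (x + y) z = cinner x z + cinner y z"
    and cinner_scaleC_left [simp]: "cinner (a *\<^sub>C x) y = a * cinner x y"
    and cinner_self: "cinner x x = complex_of_real ((norm x)\<^sup>2)"

class chilbert_space = complex_inner + complete_space

lemma cinner_add_right: "cinner x (y + z) = cinner x y + cinner x z"
  by (metis cinner_add_left cinner_commute complex_cnj_add)

lemma cinner_scaleC_right [simp]: "cinner x (a *\<^sub>C y) = cnj a * cinner x y"
  by (metis cinner_commute cinner_scaleC_left complex_cnj_mult)

lemma cinner_scaleR_left [simp]: "cinner (r *\<^sub>R x) y = of_real r * cinner x y"
  by (metis cinner_scaleC_left scaleC_of_real)

lemma cinner_scaleR_right [simp]: "cinner x (r *\<^sub>R y) = of_real r * cinner x y"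
  by (metis cinner_scaleC_right complex_cnj_complex_of_real scaleC_of_real)

lemma cinner_zero_left [simp]: "cinner 0 y = 0"
  using cinner_scaleR_left[of 0 0 y] by simp

lemma cinner_zero_right [simp]: "cinner x 0 = 0"
  using cinner_scaleR_right[of x 0 0] by simp

lemma cinner_minus_left [simp]: "cinner (- x) y = - cinner x y"
  using cinner_scaleR_left[of "-1" x y] by simp

lemma cinner_minus_right [simp]: "cinner x (- y) = - cinner x y"
  using cinner_scaleR_right[of x "-1" y] by simp

lemma cinner_diff_left: "cinner (x - y) z = cinner x z - cinner y z"
  using cinner_add_left[of x "- y" z] by simp

lemma cinner_diff_right: "cinner x (y - z) = cinner x y - cinner x z"
  using cinner_add_right[of x y "- z"] by simp

lemma cinner_eqI:
  assumes "\<And>z. cinner z x = cinner z y"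
  shows "x = y"
proof -
  have "cinner (x - y) (x - y) = 0"
    using assms[of "x - y"] by (simp add: cinner_diff_right)
  then show ?thesis by (simp add: cinner_self)
qed

lemma norm_scaleC [simp]: "norm (a *\<^sub>C x) = cmod a * norm x"
proof -
  have "complex_of_real ((norm (a *\<^sub>C x))\<^sup>2) = (a * cnj a) * cinner x x"
    unfolding cinner_self[symmetric] by simp
  also have "\<dots> = complex_of_real ((cmod a * norm x)\<^sup>2)"
    by (simp add: cinner_self complex_norm_square[symmetric] power_mult_distrib)
  finally have "(norm (a *\<^sub>C x))\<^sup>2 = (cmod a * norm x)\<^sup>2"
    using of_real_eq_iff by blast
  then show ?thesis by (simp add: power2_eq_iff_nonneg)
qed

lemma norm_add_sq: "(norm (x + y))\<^sup>2 = (norm x)\<^sup>2 + (norm y)\<^sup>2 + 2 * Re (cinner x y)"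
proof -
  have "complex_of_real ((norm (x + y))\<^sup>2)
      = of_real ((norm x)\<^sup>2) + of_real ((norm y)\<^sup>2) + (cinner x y + cnj (cinner x y))"
    unfolding cinner_self[symmetric] cinner_commute[of y x, symmetric]
    by (simp add: cinner_add_left cinner_add_right)
  then have "Re (complex_of_real ((norm (x + y))\<^sup>2))
      = (norm x)\<^sup>2 + (norm y)\<^sup>2 + 2 * Re (cinner x y)"
    by simp
  then show ?thesis by simp
qed

lemma norm_diff_sq: "(norm (x - y))\<^sup>2 = (norm x)\<^sup>2 + (norm y)\<^sup>2 - 2 * Re (cinner x y)"
  using norm_add_sq[of x "- y"] by simp

lemma parallelogram:
  fixes x y :: "'a::complex_inner"
  shows "(norm (x + y))\<^sup>2 + (norm (x - y))\<^sup>2 = 2 * (norm x)\<^sup>2 + 2 * (norm y)\<^sup>2"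
  by (simp add: norm_add_sq norm_diff_sq)

lemma Re_cinner_le: "Re (cinner x y) \<le> norm x * norm y"
proof -
  have "(norm (x + y))\<^sup>2 \<le> (norm x + norm y)\<^sup>2"
    by (simp add: norm_triangle_ineq power_mono)
  then show ?thesis by (simp add: norm_add_sq power2_sum)
qed

lemma cmod_cinner_le: "cmod (cinner x y) \<le> norm x * norm y"
proof (cases "cinner x y = 0")
  case False
  define u where "u = cnj (cinner x y) / cmod (cinner x y)"
  have "u * cinner x y = of_real (cmod (cinner x y))"
    using False by (simp add: u_def complex_norm_square[symmetric] power2_eq_square mult.commute)
  then have "cmod (cinner x y) = Re (cinner (u *\<^sub>C x) y)" by simp
  also have "\<dots> \<le> norm (u *\<^sub>C x) * norm y" by (rule Re_cinner_le)
  also have "\<dots> = norm x * norm y" using False by (simp add: u_def norm_divide)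
  finally show ?thesis .
qed simp

definition bounded_clinear :: "('a::complex_inner \<Rightarrow> 'b::complex_inner) \<Rightarrow> bool" where
  "bounded_clinear T \<longleftrightarrow> bounded_linear T \<and> (\<forall>c x. T (c *\<^sub>C x) = c *\<^sub>C T x)"

text \<open>The adjoint exists and is unique for bounded operators on a Hilbert space; see
  \<open>cinner_cadjoint\<close> and \<open>cadjoint_unique\<close> below.\<close>

definition cadjoint :: "('a::complex_inner \<Rightarrow> 'b::complex_inner) \<Rightarrow> 'b \<Rightarrow> 'a" where
  "cadjoint T = (SOME S. \<forall>x y. cinner (T x) y = cinner x (S y))"

text \<open>An orthonormal basis of a Hilbert space is a maximal orthonormal set, that is, one whose
  orthogonal complement is trivial.\<close>

definition orthonormal :: "'a::complex_inner set \<Rightarrow> bool" where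
  "orthonormal E \<longleftrightarrow> (\<forall>x\<in>E. \<forall>y\<in>E. cinner x y = (if x = y then 1 else 0))"

definition orthonormal_basis :: "'a::complex_inner set \<Rightarrow> bool" where
  "orthonormal_basis E \<longleftrightarrow> orthonormal E \<and> (\<forall>x. (\<forall>e\<in>E. cinner x e = 0) \<longrightarrow> x = 0)"

subsection \<open>Riesz representation and adjoints\<close>

lemma riesz_real:
  fixes \<phi> :: "'a::chilbert_space \<Rightarrow> real"
  assumes "bounded_linear \<phi>"
  shows "\<exists>y. \<forall>x. \<phi> x = Re (cinner x y)"
proof -
  interpret bounded_linear \<phi> by fact
  obtain K where K: "\<And>x. \<bar>\<phi> x\<bar> \<le> norm x * K" using bounded by auto
  define F where "F x = (norm x)\<^sup>2 - 2 * \<phi> x" for x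
  have lower: "- K\<^sup>2 \<le> F x" for x
  proof -
    have "0 \<le> (norm x - K)\<^sup>2" by simp
    then show ?thesis using K[of x] by (simp add: F_def power2_diff)
  qed
  define m where "m = (INF x. F x)"
  have bdd: "bdd_below (range F)" using lower by (auto intro!: bdd_belowI)
  have m_le: "m \<le> F x" for x unfolding m_def using bdd by (simp add: cINF_lower)
  have "\<exists>x. F x < m + 1 / real (Suc n)" for n
  proof -
    have "Inf (range F) < m + 1 / real (Suc n)" by (simp add: m_def)
    then show ?thesis using cInf_lessD[of "range F"] by blast
  qed
  then obtain X where X: "\<And>n. F (X n) < m + 1 / real (Suc n)" by metis
  have mid: "(norm (x - y))\<^sup>2 \<le> 2 * (F x - m) + 2 * (F y - m)" for x y
  proof -
    have "F ((1/2) *\<^sub>R (x + y)) = (norm (x + y))\<^sup>2 / 4 - (\<phi> x + \<phi> y)"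
      by (simp only: F_def scaleR norm_scaleR add) (simp add: power_divide field_simps)
    then show ?thesis
      using m_le[of "(1/2) *\<^sub>R (x + y)"] parallelogram[of x y] by (simp add: F_def)
  qed
  have "Cauchy X"
  proof (rule metric_CauchyI)
    fix e :: real assume "0 < e"
    then obtain N where N: "4 / e\<^sup>2 < real N" using reals_Archimedean2 by blast
    have small: "F (X n) - m < e\<^sup>2 / 4" if "N \<le> n" for n
    proof -
      have "4 / e\<^sup>2 < real (Suc n)" using N that by linarith
      then have "1 / real (Suc n) < e\<^sup>2 / 4" using \<open>0 < e\<close> by (simp add: field_simps)
      then show ?thesis using X[of n] by linarith
    qed
    show "\<exists>M. \<forall>p\<ge>M. \<forall>n\<ge>M. dist (X p) (X n) < e"
    proof (intro exI allI impI)
      fix p n assume pn: "N \<le> p" "N \<le> n"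
      have "(norm (X p - X n))\<^sup>2 < e\<^sup>2"
        using mid[of "X p" "X n"] small[OF pn(1)] small[OF pn(2)] by (simp add: field_simps)
      then show "dist (X p) (X n) < e"
        using \<open>0 < e\<close> by (simp add: dist_norm power2_less_imp_less)
    qed
  qed
  then obtain y where y: "X \<longlonglongrightarrow> y" by (auto simp: Cauchy_convergent_iff convergent_def)
  have "(\<lambda>n. F (X n)) \<longlonglongrightarrow> F y" unfolding F_def by (intro tendsto_intros y tendsto)
  moreover have "(\<lambda>n. m + 1 / real (Suc n)) \<longlonglongrightarrow> m + 0"
    by (intro tendsto_intros LIMSEQ_Suc[OF lim_1_over_n])
  ultimately have "F y \<le> m + 0"
    by (rule LIMSEQ_le) (use X less_imp_le in blast)
  then have min: "F y \<le> F x" for x using m_le[of x] by linarith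
  have "\<phi> x = Re (cinner x y)" for x
  proof (rule ccontr)
    define d where "d = \<phi> x - Re (cinner x y)"
    assume "\<phi> x \<noteq> Re (cinner x y)"
    then have d: "d \<noteq> 0" by (simp add: d_def)
    have var: "2 * t * d \<le> t\<^sup>2 * (norm x)\<^sup>2" for t
    proof -
      have "F (y + t *\<^sub>R x) = F y + t\<^sup>2 * (norm x)\<^sup>2 - 2 * t * d"
        using cinner_commute[of x y]
        by (simp add: F_def norm_add_sq add scaleR d_def power_mult_distrib algebra_simps)
      then show ?thesis using min[of "y + t *\<^sub>R x"] by linarith
    qed
    define t where "t = d / ((norm x)\<^sup>2 + 1)"
    have pos: "0 < (norm x)\<^sup>2 + 1" by (simp add: add_nonneg_pos)
    have "t * ((norm x)\<^sup>2 + 1) = d" using pos by (simp add: t_def)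
    then have "2 * t * d = 2 * t\<^sup>2 * ((norm x)\<^sup>2 + 1)" by (metis mult.assoc mult.commute power2_eq_square)
    moreover have "0 < t\<^sup>2" using d pos by (simp add: t_def)
    moreover have "0 \<le> t\<^sup>2 * (norm x)\<^sup>2" by simp
    ultimately show False using var[of t] unfolding distrib_left mult_1_right by linarith
  qed
  then show ?thesis by blast
qed

lemma cadjoint_ex:
  fixes T :: "'a::chilbert_space \<Rightarrow> 'b::complex_inner"
  assumes "bounded_clinear T"
  shows "\<exists>S. \<forall>x y. cinner (T x) y = cinner x (S y)"
proof -
  have bl: "bounded_linear T" and sc: "\<And>c x. T (c *\<^sub>C x) = c *\<^sub>C T x"
    using assms by (auto simp: bounded_clinear_def)
  have "\<exists>z. \<forall>x. cinner (T x) y = cinner x z" for y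
  proof -
    have "bounded_linear (\<lambda>x. Re (cinner x y))"
    proof (rule bounded_linear_intro[where K = "norm y"])
      fix x show "norm (Re (cinner x y)) \<le> norm x * norm y"
        using abs_Re_le_cmod cmod_cinner_le order_trans by fastforce
    qed (simp_all add: cinner_add_left)
    then have "bounded_linear (\<lambda>x. Re (cinner (T x) y))"
      using bl by (rule bounded_linear_compose)
    then obtain z where z: "\<And>x. Re (cinner (T x) y) = Re (cinner x z)"
      using riesz_real by blast
    have "cinner (T x) y = cinner x z" for x
      using z[of x] z[of "\<i> *\<^sub>C x"] by (simp add: sc complex_eq_iff)
    then show ?thesis by blast
  qed
  then show ?thesis by metis
qed

lemma cinner_cadjoint:
  fixes T :: "'a::chilbert_space \<Rightarrow> 'b::complex_inner"
  assumes "bounded_clinear T"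
  shows "cinner (T x) y = cinner x (cadjoint T y)"
  using someI_ex[OF cadjoint_ex[OF assms]] unfolding cadjoint_def by blast

lemma cadjoint_unique:
  assumes "\<And>x y. cinner (T x) y = cinner x (S y)"
  shows "cadjoint T = S"
proof -
  have "\<forall>x y. cinner (T x) y = cinner x (cadjoint T y)"
    unfolding cadjoint_def
    by (rule someI[where P = "\<lambda>S. \<forall>x y. cinner (T x) y = cinner x (S y)" and x = S])
      (simp add: assms)
  then have "cinner x (cadjoint T y) = cinner x (S y)" for x y
    using assms[of x y] by simp
  then show ?thesis by (intro ext) (rule cinner_eqI)
qed

lemma orthonormalD:
  assumes "orthonormal E" "x \<in> E" "y \<in> E"
  shows "cinner x y = (if x = y then 1 else 0)"
  using assms(1)[unfolded orthonormal_def, rule_format, OF assms(2,3)] .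

lemma orthonormal_Union:
  assumes "subset.chain (Collect orthonormal) C"
  shows "orthonormal (\<Union>C)"
  unfolding orthonormal_def
proof (intro ballI)
  fix x y assume "x \<in> \<Union>C" "y \<in> \<Union>C"
  then obtain A B where AB: "x \<in> A" "A \<in> C" "y \<in> B" "B \<in> C" by (elim UnionE)
  have on: "orthonormal A" "orthonormal B"
    using assms AB(2,4) unfolding subset_chain_def by auto
  have "A \<subseteq> B \<or> B \<subseteq> A"
    using assms AB(2,4) unfolding subset_chain_def by auto
  then show "cinner x y = (if x = y then 1 else 0)"
  proof
    assume "A \<subseteq> B"
    then show ?thesis using orthonormalD[OF on(2) _ AB(3)] AB(1) subsetD by metis
  next
    assume "B \<subseteq> A"
    then show ?thesis using orthonormalD[OF on(1) AB(1)] AB(3) subsetD by metis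
  qed
qed

lemma orthonormal_insert:
  assumes E: "orthonormal E" and u: "norm u = 1" and ue: "\<And>e. e \<in> E \<Longrightarrow> cinner u e = 0"
  shows "orthonormal (insert u E)" and "u \<notin> E"
proof -
  have uu: "cinner u u = 1" using u by (simp add: cinner_self)
  show "u \<notin> E" using ue[of u] uu by auto
  have eu: "cinner e u = 0" if "e \<in> E" for e
    using ue[OF that] cinner_commute[of e u] by simp
  show "orthonormal (insert u E)"
    unfolding orthonormal_def
  proof (intro ballI)
    fix y z assume "y \<in> insert u E" "z \<in> insert u E"
    then consider "y = u" "z = u" | "y = u" "z \<in> E" | "y \<in> E" "z = u" | "y \<in> E" "z \<in> E"
      by (elim insertE)
    then show "cinner y z = (if y = z then 1 else 0)"
    proof cases
      case 1 then show ?thesis using uu by simp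
    next
      case 2 then show ?thesis using ue \<open>u \<notin> E\<close> by auto
    next
      case 3 then show ?thesis using eu \<open>u \<notin> E\<close> by auto
    next
      case 4 then show ?thesis using orthonormalD[OF E] by simp
    qed
  qed
qed

lemma orthonormal_basis_ex: "\<exists>E :: 'a::complex_inner set. orthonormal_basis E"
proof -
  have "\<exists>M\<in>Collect orthonormal. \<forall>X\<in>Collect orthonormal. M \<subseteq> X \<longrightarrow> X = (M :: 'a set)"
    by (rule subset_Zorn') (simp add: orthonormal_Union)
  then obtain M :: "'a set" where M: "orthonormal M"
    and max: "\<And>X. orthonormal X \<Longrightarrow> M \<subseteq> X \<Longrightarrow> X = M" by (auto simp only: mem_Collect_eq)
  have "x = 0" if x: "\<forall>e\<in>M. cinner x e = 0" for x
  proof (rule ccontr)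
    assume "x \<noteq> 0"
    then have u: "norm ((1 / norm x) *\<^sub>R x) = 1" by simp
    have ue: "cinner ((1 / norm x) *\<^sub>R x) e = 0" if "e \<in> M" for e
      using x that by simp
    note ins = orthonormal_insert[OF M u ue]
    have "insert ((1 / norm x) *\<^sub>R x) M = M"
      by (rule max[OF ins(1) subset_insertI])
    then show False using ins(2) insertI1 by metis
  qed
  then have "\<forall>x. (\<forall>e\<in>M. cinner x e = 0) \<longrightarrow> x = 0" by (intro allI impI)
  with M have "orthonormal_basis M" unfolding orthonormal_basis_def by (rule conjI)
  then show ?thesis by (rule exI)
qed


section \<open>The Hilbert--Schmidt class\<close>

text \<open>The trace is evaluated in one fixed orthonormal basis: for trace-class operators, such as
  the products $S^*T$ of two Hilbert--Schmidt operators, the choice does not matter. Likewise,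
  square-summability of $\Vert Te\Vert$ over one orthonormal basis implies it over every one.\<close>

definition some_onb :: "'a::complex_inner set" where
  "some_onb = (SOME E. orthonormal_basis E)"

definition ctrace :: "('a::complex_inner \<Rightarrow> 'a) \<Rightarrow> complex" where
  "ctrace A = (\<Sum>\<^sub>\<infinity>e\<in>some_onb. cinner (A e) e)"

definition hilbert_schmidt_op :: "('a::complex_inner \<Rightarrow> 'a) \<Rightarrow> bool" where
  "hilbert_schmidt_op T \<longleftrightarrow> bounded_clinear T \<and>
     (\<forall>E. orthonormal_basis E \<longrightarrow> (\<lambda>e. (norm (T e))\<^sup>2) summable_on E)"

lemma orthonormal_basis_some_onb: "orthonormal_basis (some_onb :: 'a::chilbert_space set)"
  unfolding some_onb_def using orthonormal_basis_ex by (rule someI_ex)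

lemma bounded_clinear_zero: "bounded_clinear (\<lambda>x. 0)"
  unfolding bounded_clinear_def
proof (intro conjI allI)
  show "(0::'b) = c *\<^sub>C 0" for c
    using scaleC_add_right[of c "0::'b" 0] by simp
qed simp

lemma hilbert_schmidt_op_zero: "hilbert_schmidt_op (\<lambda>x. 0)"
  by (simp add: hilbert_schmidt_op_def bounded_clinear_zero)

lemma norm_add_sq_le:
  fixes x y :: "'a::complex_inner"
  shows "(norm (x + y))\<^sup>2 \<le> 2 * (norm x)\<^sup>2 + 2 * (norm y)\<^sup>2"
  using parallelogram[of x y] zero_le_power2[of "norm (x - y)"] by linarith

lemma hilbert_schmidt_op_add:
  assumes "hilbert_schmidt_op S" "hilbert_schmidt_op T"
  shows "hilbert_schmidt_op (\<lambda>x. S x + T x)"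
proof -
  have "(\<lambda>e. (norm (S e + T e))\<^sup>2) summable_on E" if "orthonormal_basis E" for E
  proof (rule summable_on_comparison_test)
    show "(\<lambda>e. 2 * (norm (S e))\<^sup>2 + 2 * (norm (T e))\<^sup>2) summable_on E"
      using assms that unfolding hilbert_schmidt_op_def
      by (intro summable_on_add summable_on_cmult_right) auto
  qed (simp_all add: norm_add_sq_le)
  then show ?thesis
    using assms unfolding hilbert_schmidt_op_def bounded_clinear_def
    by (simp add: bounded_linear_add scaleC_add_right)
qed

lemma bounded_linear_scaleC: "bounded_linear (\<lambda>x::'a::complex_inner. c *\<^sub>C x)"
proof (rule bounded_linear_intro[where K = "cmod c"])
  show "c *\<^sub>C r *\<^sub>R x = r *\<^sub>R c *\<^sub>C x" for r and x :: 'a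
    by (simp add: scaleC_of_real[symmetric] mult.commute)
qed (simp_all add: scaleC_add_right mult.commute)

lemma hilbert_schmidt_op_scaleC:
  assumes "hilbert_schmidt_op T"
  shows "hilbert_schmidt_op (\<lambda>x. c *\<^sub>C T x)"
proof -
  have "bounded_linear (\<lambda>x. c *\<^sub>C T x)"
    using assms unfolding hilbert_schmidt_op_def bounded_clinear_def
    by (intro bounded_linear_compose[OF bounded_linear_scaleC]) auto
  then show ?thesis
    using assms unfolding hilbert_schmidt_op_def bounded_clinear_def
    by (auto simp: power_mult_distrib mult.commute intro!: summable_on_cmult_right)
qed

lemma hilbert_schmidt_op_scaleR:
  assumes "hilbert_schmidt_op T"
  shows "hilbert_schmidt_op (\<lambda>x. r *\<^sub>R T x)"
  using hilbert_schmidt_op_scaleC[OF assms, of "of_real r"] by (simp add: scaleC_of_real)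

lemma hilbert_schmidt_op_uminus:
  assumes "hilbert_schmidt_op T"
  shows "hilbert_schmidt_op (\<lambda>x. - T x)"
  using hilbert_schmidt_op_scaleR[OF assms, of "-1"] by simp

lemma hilbert_schmidt_op_diff:
  assumes "hilbert_schmidt_op S" "hilbert_schmidt_op T"
  shows "hilbert_schmidt_op (\<lambda>x. S x - T x)"
  using hilbert_schmidt_op_add[OF assms(1) hilbert_schmidt_op_uminus[OF assms(2)]] by simp

typedef (overloaded) 'a hilbert_schmidt = "{T :: 'a::complex_inner \<Rightarrow> 'a. hilbert_schmidt_op T}"
  morphisms hs_apply Abs_hs
  using hilbert_schmidt_op_zero by blast

setup_lifting type_definition_hilbert_schmidt

lemma hs_apply_hs: "hilbert_schmidt_op (hs_apply T)"
  using hs_apply by blast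

lemma bounded_clinear_hs_apply: "bounded_clinear (hs_apply T)"
  using hs_apply_hs hilbert_schmidt_op_def by blast

lemma hs_eqI: "(\<And>x. hs_apply S x = hs_apply T x) \<Longrightarrow> S = T"
  by (metis hs_apply_inject ext)

instantiation hilbert_schmidt :: (complex_inner) real_vector
begin

lift_definition zero_hilbert_schmidt :: "'a hilbert_schmidt" is "\<lambda>x. 0"
  by (rule hilbert_schmidt_op_zero)
lift_definition plus_hilbert_schmidt :: "'a hilbert_schmidt \<Rightarrow> 'a hilbert_schmidt \<Rightarrow> 'a hilbert_schmidt"
  is "\<lambda>S T x. S x + T x" by (rule hilbert_schmidt_op_add)
lift_definition minus_hilbert_schmidt :: "'a hilbert_schmidt \<Rightarrow> 'a hilbert_schmidt \<Rightarrow> 'a hilbert_schmidt"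
  is "\<lambda>S T x. S x - T x" by (rule hilbert_schmidt_op_diff)
lift_definition uminus_hilbert_schmidt :: "'a hilbert_schmidt \<Rightarrow> 'a hilbert_schmidt"
  is "\<lambda>T x. - T x" by (rule hilbert_schmidt_op_uminus)
lift_definition scaleR_hilbert_schmidt :: "real \<Rightarrow> 'a hilbert_schmidt \<Rightarrow> 'a hilbert_schmidt"
  is "\<lambda>r T x. r *\<^sub>R T x" by (rule hilbert_schmidt_op_scaleR)

instance
  by standard (transfer; simp add: algebra_simps)+

end

text \<open>The inner product is $[T,S]_\tau = \tau(S^*T)$ and the norm is
  $\Vert T\Vert_2 = [T,T]_\tau^{1/2}$; the remaining constants are those every normed space
  derives from the norm.\<close>

instantiation hilbert_schmidt :: (chilbert_space) complex_inner
begin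

lift_definition scaleC_hilbert_schmidt :: "complex \<Rightarrow> 'a hilbert_schmidt \<Rightarrow> 'a hilbert_schmidt"
  is "\<lambda>c T x. c *\<^sub>C T x" by (rule hilbert_schmidt_op_scaleC)

definition cinner_hilbert_schmidt :: "'a hilbert_schmidt \<Rightarrow> 'a hilbert_schmidt \<Rightarrow> complex" where
  "cinner_hilbert_schmidt T S = ctrace (cadjoint (hs_apply S) \<circ> hs_apply T)"

definition norm_hilbert_schmidt :: "'a hilbert_schmidt \<Rightarrow> real" where
  "norm_hilbert_schmidt T = sqrt (Re (cinner T T))"

definition dist_hilbert_schmidt :: "'a hilbert_schmidt \<Rightarrow> 'a hilbert_schmidt \<Rightarrow> real" where
  "dist_hilbert_schmidt S T = norm (S - T)"

definition sgn_hilbert_schmidt :: "'a hilbert_schmidt \<Rightarrow> 'a hilbert_schmidt" where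
  "sgn_hilbert_schmidt T = inverse (norm T) *\<^sub>R T"

definition uniformity_hilbert_schmidt :: "('a hilbert_schmidt \<times> 'a hilbert_schmidt) filter" where
  "uniformity_hilbert_schmidt = (INF e\<in>{0 <..}. principal {(S, T). dist S T < e})"

definition open_hilbert_schmidt :: "'a hilbert_schmidt set \<Rightarrow> bool" where
  "open_hilbert_schmidt U \<longleftrightarrow> (\<forall>x\<in>U. \<forall>\<^sub>F (x', y) in uniformity. x' = x \<longrightarrow> y \<in> U)"

lemma cinner_hs_eq: "cinner S T = (\<Sum>\<^sub>\<infinity>e\<in>some_onb. cinner (hs_apply S e) (hs_apply T e))"
  for S T :: "'a hilbert_schmidt"
proof -
  have "cinner (cadjoint (hs_apply T) y) x = cinner y (hs_apply T x)" for x y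
    using cinner_cadjoint[OF bounded_clinear_hs_apply] cinner_commute by metis
  then show ?thesis by (simp add: cinner_hilbert_schmidt_def ctrace_def)
qed

lemma hs_sq_summable: "(\<lambda>e. (norm (hs_apply T e))\<^sup>2) summable_on some_onb"
  for T :: "'a hilbert_schmidt"
  using hs_apply_hs orthonormal_basis_some_onb unfolding hilbert_schmidt_op_def by blast

lemma cinner_hs_summable: "(\<lambda>e. cinner (hs_apply S e) (hs_apply T e)) summable_on some_onb"
  for S T :: "'a hilbert_schmidt"
proof (rule abs_summable_summable, rule summable_on_comparison_test)
  show "(\<lambda>e. (norm (hs_apply S e))\<^sup>2 + (norm (hs_apply T e))\<^sup>2) summable_on some_onb"
    by (intro summable_on_add hs_sq_summable)
  fix e :: 'a
  have "0 \<le> (norm (hs_apply S e) - norm (hs_apply T e))\<^sup>2" by simp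
  then have "2 * (norm (hs_apply S e) * norm (hs_apply T e))
      \<le> (norm (hs_apply S e))\<^sup>2 + (norm (hs_apply T e))\<^sup>2" by (simp add: power2_diff)
  moreover have "0 \<le> norm (hs_apply S e) * norm (hs_apply T e)" by simp
  ultimately show "norm (cinner (hs_apply S e) (hs_apply T e))
      \<le> (norm (hs_apply S e))\<^sup>2 + (norm (hs_apply T e))\<^sup>2"
    using cmod_cinner_le[of "hs_apply S e" "hs_apply T e"] by linarith
qed simp

lemma cinner_hs_self: "cinner T T = of_real (\<Sum>\<^sub>\<infinity>e\<in>some_onb. (norm (hs_apply T e))\<^sup>2)"
  for T :: "'a hilbert_schmidt"
  unfolding cinner_hs_eq cinner_self
  by (rule infsumI) (intro has_sum_of_real has_sum_infsum hs_sq_summable)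

lemma norm_hs_eq: "norm T = sqrt (\<Sum>\<^sub>\<infinity>e\<in>some_onb. (norm (hs_apply T e))\<^sup>2)"
  for T :: "'a hilbert_schmidt"
  by (simp add: norm_hilbert_schmidt_def cinner_hs_self)

lemma norm_hs_sq: "(norm T)\<^sup>2 = (\<Sum>\<^sub>\<infinity>e\<in>some_onb. (norm (hs_apply T e))\<^sup>2)"
  for T :: "'a hilbert_schmidt"
  by (simp add: norm_hs_eq infsum_nonneg)

instance
proof
  fix S T U :: "'a hilbert_schmidt" and a b :: complex and r :: real
  show "dist S T = norm (S - T)" by (rule dist_hilbert_schmidt_def)
  show "sgn T = inverse (norm T) *\<^sub>R T" by (rule sgn_hilbert_schmidt_def)
  show "(uniformity :: ('a hilbert_schmidt \<times> 'a hilbert_schmidt) filter)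
      = (INF e\<in>{0 <..}. principal {(S, T). dist S T < e})"
    by (rule uniformity_hilbert_schmidt_def)
  show "open V \<longleftrightarrow> (\<forall>x\<in>V. \<forall>\<^sub>F (x', y) in uniformity. x' = x \<longrightarrow> y \<in> V)"
    for V :: "'a hilbert_schmidt set"
    by (rule open_hilbert_schmidt_def)
  show "norm T = 0 \<longleftrightarrow> T = 0"
  proof
    assume "norm T = 0"
    then have "(\<Sum>\<^sub>\<infinity>e\<in>some_onb. (norm (hs_apply T e))\<^sup>2) \<le> 0"
      by (simp add: norm_hs_eq)
    then have "(norm (hs_apply T e))\<^sup>2 = 0" if "e \<in> some_onb" for e
      using that by (intro nonneg_infsum_le_0D[where A = some_onb and f = "\<lambda>e. (norm (hs_apply T e))\<^sup>2"])
        (auto simp: hs_sq_summable)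
    then have "cinner (cadjoint (hs_apply T) y) e = 0" if "e \<in> some_onb" for e y
      using that cinner_cadjoint[OF bounded_clinear_hs_apply, of T e y]
        cinner_commute[of "cadjoint (hs_apply T) y" e] by simp
    then have "cadjoint (hs_apply T) y = 0" for y
      using orthonormal_basis_some_onb unfolding orthonormal_basis_def by blast
    then have "cinner z (hs_apply T x) = cinner z 0" for x z
      using cinner_cadjoint[OF bounded_clinear_hs_apply, of T x z] cinner_commute[of z "hs_apply T x"]
      by simp
    then have "hs_apply T x = 0" for x by (rule cinner_eqI)
    then show "T = 0" by (intro hs_eqI) (simp add: zero_hilbert_schmidt.rep_eq)
  qed (simp add: norm_hs_eq zero_hilbert_schmidt.rep_eq)
  show "norm (S + T) \<le> norm S + norm T"
  proof -
    have "(norm (S + T))\<^sup>2 \<le> (norm S + norm T)\<^sup>2"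
      unfolding norm_hs_sq[of "S + T"]
    proof (rule infsum_le_finite_sums[OF hs_sq_summable])
      fix F :: "'a set" assume F: "finite F" "F \<subseteq> some_onb"
      have part: "L2_set (\<lambda>e. norm (hs_apply V e)) F \<le> norm V" for V :: "'a hilbert_schmidt"
        unfolding L2_set_def norm_hs_eq
        by (intro real_sqrt_le_mono finite_sum_le_infsum hs_sq_summable F) auto
      have "L2_set (\<lambda>e. norm (hs_apply (S + T) e)) F
          \<le> L2_set (\<lambda>e. norm (hs_apply S e) + norm (hs_apply T e)) F"
        by (intro L2_set_mono) (simp_all add: plus_hilbert_schmidt.rep_eq norm_triangle_ineq)
      also have "\<dots> \<le> norm S + norm T"
        by (rule order_trans[OF L2_set_triangle_ineq add_mono[OF part part]])
      finally have "(L2_set (\<lambda>e. norm (hs_apply (S + T) e)) F)\<^sup>2 \<le> (norm S + norm T)\<^sup>2"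
        by (intro power_mono) (auto simp: L2_set_nonneg)
      then show "(\<Sum>e\<in>F. (norm (hs_apply (S + T) e))\<^sup>2) \<le> (norm S + norm T)\<^sup>2"
        by (simp add: L2_set_def sum_nonneg)
    qed
    moreover have "0 \<le> norm S + norm T" by (simp add: norm_hs_eq infsum_nonneg)
    ultimately show ?thesis by (rule power2_le_imp_le)
  qed
  show "norm (r *\<^sub>R T) = \<bar>r\<bar> * norm T"
    by (simp add: norm_hs_eq scaleR_hilbert_schmidt.rep_eq power_mult_distrib
        infsum_cmult_right' real_sqrt_mult)
  show "a *\<^sub>C (S + T) = a *\<^sub>C S + a *\<^sub>C T"
    by (intro hs_eqI) (simp add: scaleC_hilbert_schmidt.rep_eq plus_hilbert_schmidt.rep_eq scaleC_add_right)
  show "(a + b) *\<^sub>C T = a *\<^sub>C T + b *\<^sub>C T"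
    by (intro hs_eqI) (simp add: scaleC_hilbert_schmidt.rep_eq plus_hilbert_schmidt.rep_eq scaleC_add_left)
  show "a *\<^sub>C b *\<^sub>C T = (a * b) *\<^sub>C T"
    by (intro hs_eqI) (simp add: scaleC_hilbert_schmidt.rep_eq)
  show "complex_of_real r *\<^sub>C T = r *\<^sub>R T"
    by (intro hs_eqI) (simp add: scaleC_hilbert_schmidt.rep_eq scaleR_hilbert_schmidt.rep_eq scaleC_of_real)
  show "cinner S T = cnj (cinner T S)"
    unfolding cinner_hs_eq infsum_cnj[symmetric] cinner_commute[symmetric] ..
  show "cinner (S + T) U = cinner S U + cinner T U"
    by (simp add: cinner_hs_eq plus_hilbert_schmidt.rep_eq cinner_add_left infsum_add cinner_hs_summable)
  show "cinner (a *\<^sub>C S) T = a * cinner S T"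
    by (simp add: cinner_hs_eq scaleC_hilbert_schmidt.rep_eq infsum_cmult_right')
  show "cinner T T = complex_of_real ((norm T)\<^sup>2)"
    unfolding cinner_hs_self norm_hs_sq ..
qed

end


section \<open>Hilbert--Schmidt frames\<close>

definition hs_frame ::
    "'j set \<Rightarrow> ('j \<Rightarrow> 'h::chilbert_space \<Rightarrow> 'k::chilbert_space hilbert_schmidt) \<Rightarrow> bool" where
  "hs_frame J G \<longleftrightarrow> (\<forall>j\<in>J. bounded_clinear (G j)) \<and>
     (\<exists>A>0. \<exists>B>0. \<forall>f. (\<lambda>j. (norm (G j f))\<^sup>2) summable_on J \<and>
        A * (norm f)\<^sup>2 \<le> (\<Sum>\<^sub>\<infinity>j\<in>J. (norm (G j f))\<^sup>2) \<and>
        (\<Sum>\<^sub>\<infinity>j\<in>J. (norm (G j f))\<^sup>2) \<le> B * (norm f)\<^sup>2)"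

definition alternate_dual_hs_frame ::
    "'j set \<Rightarrow> ('j \<Rightarrow> 'h::chilbert_space \<Rightarrow> 'k::chilbert_space hilbert_schmidt)
      \<Rightarrow> ('j \<Rightarrow> 'h \<Rightarrow> 'k hilbert_schmidt) \<Rightarrow> bool" where
  "alternate_dual_hs_frame J G \<Gamma> \<longleftrightarrow> hs_frame J \<Gamma> \<and>
     (\<forall>f. ((\<lambda>j. cadjoint (G j) (\<Gamma> j f)) has_sum f) J \<and>
          ((\<lambda>j. cadjoint (\<Gamma> j) (G j f)) has_sum f) J)"

end

theory Submission
  imports Defs
begin

text \<open>
  Put $S = \sum_j w_j\, G_j^* \Gamma_j f$. Duality gives $\sum_j (1-w_j)\, G_j^*\Gamma_j f = f - S$,
  and pairing with \<open>f\<close> turns the two scalar series into $\langle S, f\rangle$ and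
  $\langle f - S, f\rangle$. The identity then reads
  $\langle S, f\rangle + \Vert f - S\Vert^2 = \overline{\langle f - S, f\rangle} + \Vert S\Vert^2$,
  which follows by expanding the square. Unconditional convergence of \<open>S\<close> holds because the
  synthesis operator of a frame is bounded on square-summable families.
\<close>

text \<open>Cauchy criterion for unconditional sums. The partial sum over any finite superset of
  \<open>F0\<close> differs from the one over \<open>F0\<close> by a tail sum below
  \<open>e / 2\<close>, so the net of partial sums is Cauchy and completeness supplies a
  limit.\<close>

lemma summable_on_Cauchy_complete:
  fixes f :: "'i \<Rightarrow> 'b::{real_normed_vector, complete_space}"
  assumes tail: "\<And>e. e > 0 \<Longrightarrow>
      \<exists>F0. finite F0 \<and> F0 \<subseteq> A \<and> (\<forall>F. finite F \<and> F \<subseteq> A - F0 \<longrightarrow> norm (sum f F) < e)"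
  shows "f summable_on A"
proof -
  have "\<exists>P. eventually P (finite_subsets_at_top A) \<and>
      (\<forall>F F'. P F \<and> P F' \<longrightarrow> dist (sum f F) (sum f F') < e)" if e: "e > 0" for e
  proof -
    obtain F0 where F0: "finite F0" "F0 \<subseteq> A"
      and small: "\<forall>F. finite F \<and> F \<subseteq> A - F0 \<longrightarrow> norm (sum f F) < e / 2"
      using tail[OF half_gt_zero[OF e]] by (elim exE conjE)
    define P where "P F \<longleftrightarrow> finite F \<and> F0 \<subseteq> F \<and> F \<subseteq> A" for F
    have "eventually P (finite_subsets_at_top A)"
      using F0 by (auto simp: eventually_finite_subsets_at_top P_def intro!: exI[of _ F0])
    moreover have "dist (sum f F) (sum f F') < e" if P: "P F" "P F'" for F F'
    proof -
      have near: "dist (sum f H) (sum f F0) < e / 2" if "P H" for H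
      proof -
        have "sum f H - sum f F0 = sum f (H - F0)"
          using that by (intro sum_diff[symmetric]) (auto simp: P_def)
        then show ?thesis
          using that small[rule_format, of "H - F0"] by (auto simp: dist_norm P_def)
      qed
      show ?thesis
        using near[OF P(1)] near[OF P(2)] by (rule dist_triangle_half_l)
    qed
    ultimately show ?thesis by blast
  qed
  then have "cauchy_filter (filtermap (sum f) (finite_subsets_at_top A))"
    by (simp add: cauchy_filter_metric_filtermap)
  then have "convergent_filter (filtermap (sum f) (finite_subsets_at_top A))"
    by (rule cauchy_filter_convergent)
  then show ?thesis
    by (auto simp: convergent_filter_iff summable_on_def has_sum_def filterlim_def)
qed

text \<open>Choose \<open>F0\<close> with its sum within \<open>d\<close> of the total. By
  nonnegativity no finite sum exceeds the total, so a finite set disjoint from \<open>F0\<close>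
  contributes less than \<open>d\<close>.\<close>

lemma summable_on_real_tail:
  fixes g :: "'i \<Rightarrow> real"
  assumes "g summable_on A" and nonneg: "\<And>i. i \<in> A \<Longrightarrow> 0 \<le> g i" and "d > 0"
  obtains F0 where "finite F0" "F0 \<subseteq> A" "\<And>F. finite F \<Longrightarrow> F \<subseteq> A - F0 \<Longrightarrow> sum g F < d"
proof -
  have "(sum g \<longlongrightarrow> infsum g A) (finite_subsets_at_top A)"
    using has_sum_infsum[OF assms(1)] by (simp add: has_sum_def)
  then have "\<forall>\<^sub>F F in finite_subsets_at_top A. dist (sum g F) (infsum g A) < d"
    using \<open>d > 0\<close> by (rule tendstoD)
  then obtain F0 where F0: "finite F0" "F0 \<subseteq> A" and close: "dist (sum g F0) (infsum g A) < d"
    by (auto simp: eventually_finite_subsets_at_top)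
  have "sum g F < d" if F: "finite F" "F \<subseteq> A - F0" for F
  proof -
    have "sum g F0 + sum g F = sum g (F0 \<union> F)"
      using F F0 by (intro sum.union_disjoint[symmetric]) auto
    also have "\<dots> \<le> infsum g A"
      using F F0 by (intro finite_sum_le_infsum assms(1)) (auto intro: nonneg)
    finally show ?thesis using close by (simp add: dist_real_def)
  qed
  with F0 that show thesis by blast
qed

lemma bounded_linear_cinner_left: "bounded_linear (\<lambda>x. cinner x y)"
proof (rule bounded_linear_intro[where K = "norm y"])
  show "cinner (r *\<^sub>R x) y = r *\<^sub>R cinner x y" for r x
    by (simp add: scaleR_conv_of_real)
qed (simp_all add: cinner_add_left cmod_cinner_le)

lemma cinner_sum_right: "cinner x (sum f F) = (\<Sum>i\<in>F. cinner x (f i))"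
  by (induction F rule: infinite_finite_induct) (simp_all add: cinner_add_right)

lemma cinner_cadjoint_left:
  fixes T :: "'a::chilbert_space \<Rightarrow> 'b::complex_inner"
  assumes "bounded_clinear T"
  shows "cinner (cadjoint T y) x = cinner y (T x)"
  by (metis assms cinner_cadjoint cinner_commute)

text \<open>Testing against an arbitrary vector moves the scalar out of the conjugate-linear
  argument on either side of the adjoint.\<close>

lemma cadjoint_scaleC:
  fixes T :: "'a::chilbert_space \<Rightarrow> 'b::complex_inner"
  assumes "bounded_clinear T"
  shows "cadjoint T (c *\<^sub>C y) = c *\<^sub>C cadjoint T y"
  by (rule cinner_eqI) (simp flip: cinner_cadjoint[OF assms])

text \<open>Synthesis is adjoint to the analysis map sending \<open>f\<close> to the family
  \<open>G j f\<close>, whose norm is at most \<open>sqrt B\<close> by the upper frame bound. The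
  constant is uniform in \<open>F\<close> and \<open>x\<close>, as the Cauchy criterion
  requires.\<close>

lemma hs_frame_synthesis_bound:
  assumes G: "hs_frame J G"
  obtains B where "B > 0" "\<And>F x. finite F \<Longrightarrow> F \<subseteq> J \<Longrightarrow>
    (norm (\<Sum>j\<in>F. cadjoint (G j) (x j)))\<^sup>2 \<le> B * (\<Sum>j\<in>F. (norm (x j))\<^sup>2)"
proof -
  from G obtain B where "B > 0"
    and sums: "\<And>f. (\<lambda>j. (norm (G j f))\<^sup>2) summable_on J"
    and upper: "\<And>f. (\<Sum>\<^sub>\<infinity>j\<in>J. (norm (G j f))\<^sup>2) \<le> B * (norm f)\<^sup>2"
    and lin: "\<And>j. j \<in> J \<Longrightarrow> bounded_clinear (G j)"
    unfolding hs_frame_def by blast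
  have "(norm (\<Sum>j\<in>F. cadjoint (G j) (x j)))\<^sup>2 \<le> B * (\<Sum>j\<in>F. (norm (x j))\<^sup>2)"
    if F: "finite F" "F \<subseteq> J" for F x
  proof -
    define y where "y = (\<Sum>j\<in>F. cadjoint (G j) (x j))"
    define X where "X = L2_set (\<lambda>j. norm (x j)) F"
    have "(norm y)\<^sup>2 = Re (cinner y y)" by (simp add: cinner_self)
    also have "\<dots> = (\<Sum>j\<in>F. Re (cinner y (cadjoint (G j) (x j))))"
      \<comment> \<open>Only the second argument is expanded; the intact first one becomes
        \<open>G j y\<close> once the adjoints are moved across.\<close>
      by (subst (2) y_def) (simp add: cinner_sum_right)
    also have "\<dots> = (\<Sum>j\<in>F. Re (cinner (G j y) (x j)))"
      using F by (intro sum.cong) (auto simp: cinner_cadjoint[OF lin])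
    \<comment> \<open>Cauchy-Schwarz in each term, then over \<open>F\<close>; the absolute values
      match \<open>L2_set_mult_ineq\<close>.\<close>
    also have "\<dots> \<le> (\<Sum>j\<in>F. \<bar>norm (G j y)\<bar> * \<bar>norm (x j)\<bar>)"
      by (intro sum_mono) (simp add: Re_cinner_le)
    also have "\<dots> \<le> L2_set (\<lambda>j. norm (G j y)) F * X"
      unfolding X_def by (rule L2_set_mult_ineq)
    also have "\<dots> \<le> (sqrt B * norm y) * X"
    proof (rule mult_right_mono)
      have "(\<Sum>j\<in>F. (norm (G j y))\<^sup>2) \<le> B * (norm y)\<^sup>2"
        using finite_sum_le_infsum[OF sums F, of y] upper[of y] by simp
      then show "L2_set (\<lambda>j. norm (G j y)) F \<le> sqrt B * norm y"
        unfolding L2_set_def by (metis norm_ge_zero real_sqrt_le_mono real_sqrt_mult real_sqrt_unique)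
    qed (simp add: X_def L2_set_nonneg)
    finally have "norm y * norm y \<le> norm y * (sqrt B * X)"
      by (simp add: power2_eq_square ac_simps)
    then have "norm y \<le> sqrt B * X"
      using \<open>B > 0\<close> by (cases "y = 0") (auto simp: X_def L2_set_nonneg)
    then have "(norm y)\<^sup>2 \<le> (sqrt B * X)\<^sup>2"
      by (intro power_mono) auto
    also have "\<dots> = B * (\<Sum>j\<in>F. (norm (x j))\<^sup>2)"
      using \<open>B > 0\<close> by (simp add: power_mult_distrib X_def L2_set_def sum_nonneg)
    finally show ?thesis unfolding y_def .
  qed
  with \<open>B > 0\<close> that show thesis by blast
qed

text \<open>The uniform synthesis bound turns small tails of the squared norms into small tails of
  the vector series.\<close>

lemma hs_frame_synthesis_summable:
  assumes G: "hs_frame J G" and x: "(\<lambda>j. (norm (x j))\<^sup>2) summable_on J"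
  shows "(\<lambda>j. cadjoint (G j) (x j)) summable_on J"
proof (rule summable_on_Cauchy_complete)
  fix e :: real assume "e > 0"
  obtain B where "B > 0" and B: "\<And>F. finite F \<Longrightarrow> F \<subseteq> J \<Longrightarrow>
      (norm (\<Sum>j\<in>F. cadjoint (G j) (x j)))\<^sup>2 \<le> B * (\<Sum>j\<in>F. (norm (x j))\<^sup>2)"
    using hs_frame_synthesis_bound[OF G] by metis
  have "0 < e\<^sup>2 / B" using \<open>e > 0\<close> \<open>B > 0\<close> by simp
  then obtain F0 where F0: "finite F0" "F0 \<subseteq> J"
    and small: "\<And>F. finite F \<Longrightarrow> F \<subseteq> J - F0 \<Longrightarrow> (\<Sum>j\<in>F. (norm (x j))\<^sup>2) < e\<^sup>2 / B"
    using summable_on_real_tail[OF x] by (metis zero_le_power2)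
  have "norm (\<Sum>j\<in>F. cadjoint (G j) (x j)) < e" if F: "finite F" "F \<subseteq> J - F0" for F
  proof -
    have "B * (\<Sum>j\<in>F. (norm (x j))\<^sup>2) < e\<^sup>2"
      using small[OF F] \<open>B > 0\<close> by (simp add: field_simps)
    then have "(norm (\<Sum>j\<in>F. cadjoint (G j) (x j)))\<^sup>2 < e\<^sup>2"
      using B[of F] F by force
    then show ?thesis using \<open>e > 0\<close> by (simp add: power2_less_imp_less)
  qed
  with F0 show "\<exists>F0. finite F0 \<and> F0 \<subseteq> J \<and>
      (\<forall>F. finite F \<and> F \<subseteq> J - F0 \<longrightarrow> norm (\<Sum>j\<in>F. cadjoint (G j) (x j)) < e)"
    by blast
qed

text \<open>The weights are absorbed into the family fed to synthesis: \<open>w j\<close> times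
  \<open>\<Gamma> j f\<close> stays square-summable, with a bound on the weights entering as the
  factor \<open>C\<^sup>2\<close>.\<close>

lemma hs_frame_multiplier_summable:
  assumes G: "hs_frame J G" and \<Gamma>: "hs_frame J \<Gamma>" and w: "bounded (w ` J)"
  shows "(\<lambda>j. w j *\<^sub>C cadjoint (G j) (\<Gamma> j f)) summable_on J"
proof -
  obtain C where C: "\<And>j. j \<in> J \<Longrightarrow> cmod (w j) \<le> C"
    using w by (auto simp: bounded_iff)
  have "(\<lambda>j. C\<^sup>2 * (norm (\<Gamma> j f))\<^sup>2) summable_on J"
    using \<Gamma> unfolding hs_frame_def by (intro summable_on_cmult_right) blast
  then have "(\<lambda>j. (norm (w j *\<^sub>C \<Gamma> j f))\<^sup>2) summable_on J"
    by (rule summable_on_comparison_test)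
      (auto simp: power_mult_distrib intro!: mult_right_mono power_mono C)
  then have "(\<lambda>j. cadjoint (G j) (w j *\<^sub>C \<Gamma> j f)) summable_on J"
    by (rule hs_frame_synthesis_summable[OF G])
  moreover have "cadjoint (G j) (w j *\<^sub>C \<Gamma> j f) = w j *\<^sub>C cadjoint (G j) (\<Gamma> j f)" if "j \<in> J" for j
    using G that by (simp add: hs_frame_def cadjoint_scaleC)
  ultimately show ?thesis by (simp cong: summable_on_cong)
qed

text \<open>Both sides expand to \<open>cinner f f - cinner f S + cinner S S\<close>.\<close>

lemma cinner_norm_diff_identity:
  "cinner S f + complex_of_real ((norm (f - S))\<^sup>2)
    = cnj (cinner (f - S) f) + complex_of_real ((norm S)\<^sup>2)"
proof -
  have "cnj (cinner (f - S) f) = cinner f f - cinner f S"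
    by (simp add: cinner_diff_right flip: cinner_commute[of f "f - S"])
  then show ?thesis
    unfolding cinner_self[symmetric] by (simp add: cinner_diff_left cinner_diff_right)
qed

text \<open>Summability is asserted beside the identity because
  \<open>\<Sum>\<^sub>\<infinity>\<close> takes the value 0 on a family that is not
  summable.\<close>

theorem theorem3p11:
  fixes J :: "'j set"
    and G \<Gamma> :: "'j \<Rightarrow> 'h::chilbert_space \<Rightarrow> 'k::chilbert_space hilbert_schmidt"
    and w :: "'j \<Rightarrow> complex" and f :: 'h
  assumes "countable J"
    and "hs_frame J G"
    and "alternate_dual_hs_frame J G \<Gamma>"
    and "bounded (w ` J)"
  shows "(\<lambda>j. w j * cinner (\<Gamma> j f) (G j f)) summable_on J \<and>
    (\<lambda>j. (1 - w j) * cinner (\<Gamma> j f) (G j f)) summable_on J \<and>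
    (\<lambda>j. w j *\<^sub>C cadjoint (G j) (\<Gamma> j f)) summable_on J \<and>
    (\<lambda>j. (1 - w j) *\<^sub>C cadjoint (G j) (\<Gamma> j f)) summable_on J \<and>
    (\<Sum>\<^sub>\<infinity>j\<in>J. w j * cinner (\<Gamma> j f) (G j f))
      + complex_of_real ((norm (\<Sum>\<^sub>\<infinity>j\<in>J. (1 - w j) *\<^sub>C cadjoint (G j) (\<Gamma> j f)))\<^sup>2)
    = cnj (\<Sum>\<^sub>\<infinity>j\<in>J. (1 - w j) * cinner (\<Gamma> j f) (G j f))
      + complex_of_real ((norm (\<Sum>\<^sub>\<infinity>j\<in>J. w j *\<^sub>C cadjoint (G j) (\<Gamma> j f)))\<^sup>2)"
proof -
  define u where "u j = cadjoint (G j) (\<Gamma> j f)" for j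
  define S where "S = (\<Sum>\<^sub>\<infinity>j\<in>J. w j *\<^sub>C u j)"
  have \<Gamma>: "hs_frame J \<Gamma>" and dual: "(u has_sum f) J"
    using assms(3) unfolding alternate_dual_hs_frame_def u_def by auto
  have S: "((\<lambda>j. w j *\<^sub>C u j) has_sum S) J"
    unfolding S_def u_def
    by (intro has_sum_infsum hs_frame_multiplier_summable assms \<Gamma>)
  \<comment> \<open>That the scalar 1 acts as the identity comes from \<open>scaleC_of_real\<close>
    at 1.\<close>
  have "(1 - c) *\<^sub>C x = x - c *\<^sub>C x" for c :: complex and x :: 'h
    using scaleC_add_left[of "1 - c" c x] scaleC_of_real[of 1 x] by (simp add: eq_diff_eq)
  moreover have "((\<lambda>j. - (w j *\<^sub>C u j)) has_sum - S) J"
    using S by (simp add: has_sum_uminus)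
  then have "((\<lambda>j. u j + - (w j *\<^sub>C u j)) has_sum (f + - S)) J"
    by (rule has_sum_add[OF dual])
  ultimately have D: "((\<lambda>j. (1 - w j) *\<^sub>C u j) has_sum (f - S)) J"
    by simp
  \<comment> \<open>Pairing with \<open>f\<close> is continuous and linear, so it passes through the
    sum. Generic \<open>v\<close> and \<open>T\<close> cover both the weights \<open>w j\<close>
    with sum \<open>S\<close> and the weights \<open>1 - w j\<close> with sum
    \<open>f - S\<close>.\<close>
  have pair: "((\<lambda>j. v j * cinner (\<Gamma> j f) (G j f)) has_sum cinner T f) J"
    if "((\<lambda>j. v j *\<^sub>C u j) has_sum T) J" for v T
  proof -
    have "cinner (u j) f = cinner (\<Gamma> j f) (G j f)" if "j \<in> J" for j
      using assms(2) that unfolding u_def hs_frame_def by (simp add: cinner_cadjoint_left)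
    then show ?thesis
      using has_sum_bounded_linear[OF bounded_linear_cinner_left that, of f]
      by (simp cong: has_sum_cong)
  qed
  note sums = S D pair[OF S] pair[OF D]
  show ?thesis
    unfolding u_def[symmetric] infsumI[OF S] infsumI[OF D] infsumI[OF pair[OF S]]
      infsumI[OF pair[OF D]]
    using sums[THEN has_sum_imp_summable] cinner_norm_diff_identity[of S f] by blast
qed

end
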